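(* Let Assumptions 1, 2 and 3 of the context hold for the two-stage DPG method $$u_{n+1}=e^{hJ_n}u_n+hb_1(hJ_n)g_n(u_n)+hb_2(hJ_n)g_n(u_{n_2}),\qquad u_{n_2}=u_n+h\varphi_2(hJ_n)\bigl(g_n(u_n)+J_nu_n\bigr),$$ started from the exact initial value $u_0$, with coefficients satisfying $$b_1(hJ_n)+b_2(hJ_n)=\varphi_1(hJ_n),\qquad \tfrac18\,b_2(hJ_n)=\varphi_3(hJ_n).$$ Then the method is third-order: the error $e_n=u_n-u(t_n)$ satisfies $$\|e_n\|\le Ch^3$$ uniformly in $t_n$, $0\le t_n\le T$, with a constant $C$ independent of the time-step size $h$.
   Context: Let $X$ be a Banach space with norm $\|\cdot\|$, $T>0$, and consider $u'(t)=F(u(t))$, $u(0)=u_0$ on $[0,T]$. Assumption 1: $u\in C([0,T);X)\cap C^1((0,T);X)$, and $F:X\to X$ is sufficiently many times Fréchet differentiable in a strip along the exact solution $u$ with all derivatives uniformly bounded; hence the Jacobian $J(v)=\frac{\partial F}{\partial u}(v)$ satisfies $\|J(v)-J(w)\|_{\mathcal L(X)}\le C\|v-w\|$ in a neighborhood of the exact solution. Assumption 2: the linear operator $J=J(v)$ generates a strongly continuous semigroup on $X$, with constants $C,\omega$ such that $\|e^{tJ}\|_{\mathcal L(X)}\le Ce^{\omega t}$, $t\ge0$, uniformly in a neighborhood of the exact solution (i.e. for all $v$ there). Uniform grid: $0=t_0<\dots<t_N=T$, $h=t_{n+1}-t_n$; $u(T)$ is understood by continuity. $u_n\approx u(t_n)$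 denotes the numerical solution, $J_n=\frac{\partial F}{\partial u}(u_n)$ (the scheme is presupposed to be well defined), $g_n(v)=F(v)-J_nv$. The $\varphi$-functions are $\varphi_0(z)=e^z$ and $\varphi_p(z)=\int_0^1e^{(1-\theta)z}\frac{\theta^{p-1}}{(p-1)!}\,d\theta$ for $p\ge1$; applied to $hJ$ via the semigroup $e^{tJ}$. Assumption 3 (stability): there is a constant $C_S$, uniform in $\nu$ and $n$, such that $$\Bigl\|\prod_{k=0}^{n-\nu}e^{hJ_{n-k}}\Bigr\|_{\mathcal L(X)}\le C_S,\qquad 0\le t_\nu\le t_n\le T,$$ where the product is $e^{hJ_n}e^{hJ_{n-1}}\cdots e^{hJ_\nu}$. *)

theory Defs
  imports "HOL-Analysis.Analysis"
begin

text \<open>Frechet derivative as an element of the Banach space of bounded operators, so that it can be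
  iterated; only meaningful at points of differentiability (see the lemma below).\<close>

definition fderiv :: "('a::real_normed_vector \<Rightarrow> 'b::real_normed_vector) \<Rightarrow> 'a \<Rightarrow> 'a \<Rightarrow>\<^sub>L 'b" where
  "fderiv f x = Blinfun (frechet_derivative f (at x))"

lemma has_derivative_fderiv:
  assumes "f differentiable (at x)"
  shows "(f has_derivative blinfun_apply (fderiv f x)) (at x)"
proof -
  have "(f has_derivative frechet_derivative f (at x)) (at x)"
    using assms by (simp add: frechet_derivative_works)
  then show ?thesis
    unfolding fderiv_def
    by (simp add: bounded_linear_Blinfun_apply has_derivative_bounded_linear)
qed

definition strip :: "(real \<Rightarrow> 'a::real_normed_vector) \<Rightarrow> real \<Rightarrow> real \<Rightarrow> 'a set" where
  "strip u T R = (\<Union>t\<in>{0..T}. ball (u t) R)"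

definition bounded_C3_on :: "('a::real_normed_vector \<Rightarrow> 'a) \<Rightarrow> 'a set \<Rightarrow> bool" where
  "bounded_C3_on F S \<longleftrightarrow>
     (\<forall>v\<in>S. F differentiable (at v) \<and> fderiv F differentiable (at v) \<and>
            fderiv (fderiv F) differentiable (at v)) \<and>
     bounded (fderiv F ` S) \<and> bounded (fderiv (fderiv F) ` S) \<and>
     bounded (fderiv (fderiv (fderiv F)) ` S)"

definition C0_semigroup :: "(real \<Rightarrow> 'a::real_normed_vector \<Rightarrow>\<^sub>L 'a) \<Rightarrow> bool" where
  "C0_semigroup S \<longleftrightarrow>
     S 0 = id_blinfun \<and>
     (\<forall>s\<ge>0. \<forall>t\<ge>0. S (s + t) = S s o\<^sub>L S t) \<and>
     (\<forall>x. ((\<lambda>t. S t x) \<longlongrightarrow> x) (at_right 0))"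

text \<open>The generator is everywhere defined here, because it is a Frechet derivative of a map of the
  whole space into itself.\<close>

definition generates :: "('a::real_normed_vector \<Rightarrow>\<^sub>L 'a) \<Rightarrow> (real \<Rightarrow> 'a \<Rightarrow>\<^sub>L 'a) \<Rightarrow> bool" where
  "generates A S \<longleftrightarrow> C0_semigroup S \<and> (\<forall>x. ((\<lambda>t. (S t x - x) /\<^sub>R t) \<longlongrightarrow> A x) (at_right 0))"

text \<open>\<open>sg A t\<close> is \<open>exp (t A)\<close>. A semigroup is determined by its generator for \<open>t \<ge> 0\<close> only, which is
  also the only range where \<open>sg\<close> is used; hence the choice instead of a definite description.\<close>

definition sg :: "('a::real_normed_vector \<Rightarrow>\<^sub>L 'a) \<Rightarrow> real \<Rightarrow> 'a \<Rightarrow>\<^sub>L 'a" where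
  "sg A = (SOME S. generates A S)"

text \<open>\<open>phi p h A\<close> is the operator \<open>\<phi>\<^sub>p(h A)\<close>, with the integral taken in the strong sense.\<close>

definition phi :: "nat \<Rightarrow> real \<Rightarrow> ('a::banach \<Rightarrow>\<^sub>L 'a) \<Rightarrow> 'a \<Rightarrow> 'a" where
  "phi p h A x =
     (if p = 0 then sg A h x
      else integral {0..1} (\<lambda>\<theta>. (\<theta> ^ (p - 1) / fact (p - 1)) *\<^sub>R sg A ((1 - \<theta>) * h) x))"

text \<open>\<open>op_prod A \<nu> m\<close> is the ordered product \<open>A (\<nu> + m) \<cdots> A (\<nu> + 1) A \<nu>\<close>.\<close>

primrec op_prod :: "(nat \<Rightarrow> 'a::real_normed_vector \<Rightarrow>\<^sub>L 'a) \<Rightarrow> nat \<Rightarrow> nat \<Rightarrow> 'a \<Rightarrow>\<^sub>L 'a" where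
  "op_prod A \<nu> 0 = A \<nu>"
| "op_prod A \<nu> (Suc m) = A (\<nu> + Suc m) o\<^sub>L op_prod A \<nu> m"

text \<open>\<open>U 0, \<dots>, U N\<close> are the numerical approximations with step size \<open>h\<close>. Differentiability at the
  \<open>U n\<close> is what makes the Jacobians \<open>J\<^sub>n\<close>, and so the scheme, well defined.\<close>

definition dpg2 ::
  "('a::banach \<Rightarrow> 'a) \<Rightarrow> (('a \<Rightarrow>\<^sub>L 'a) \<Rightarrow> 'a \<Rightarrow>\<^sub>L 'a) \<Rightarrow> (('a \<Rightarrow>\<^sub>L 'a) \<Rightarrow> 'a \<Rightarrow>\<^sub>L 'a) \<Rightarrow>
   'a \<Rightarrow> real \<Rightarrow> nat \<Rightarrow> (nat \<Rightarrow> 'a) \<Rightarrow> bool" where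
  "dpg2 F b1 b2 u0 h N U \<longleftrightarrow>
     U 0 = u0 \<and>
     (\<forall>n\<le>N. F differentiable (at (U n))) \<and>
     (\<forall>n<N.
        let J = fderiv F (U n);
            g = (\<lambda>v. F v - blinfun_apply J v);
            U2 = U n + h *\<^sub>R phi 2 h J (g (U n) + blinfun_apply J (U n))
        in U (Suc n) = sg J h (U n) + h *\<^sub>R b1 (h *\<^sub>R J) (g (U n)) + h *\<^sub>R b2 (h *\<^sub>R J) (g U2))"

end

theory Submission
  imports Defs
begin

text \<open>Why the method is of third order. The Jacobians \<open>J v\<close> are Frechet derivatives, hence bounded operators,
  and their norms are bounded uniformly near the solution. The semigroups and the \<open>\<phi>\<close>-functions of
  \<open>h J v\<close> therefore have Taylor expansions in \<open>h\<close> with uniform remainders (\<open>semigroup_taylor\<close>,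
  \<open>phi_taylor\<close>), and the numerical step can be compared with the exact flow by plain Taylor expansion.

  Write \<open>H\<close> for the second derivative of \<open>F\<close>. The reference is the third-order Taylor method
  \<open>v + h F + h\<^sup>2/2 J F + h\<^sup>3/6 (J J F + H F F)\<close>, all evaluated at \<open>v\<close>. The exact solution follows it up to
  \<open>O(h\<^sup>4)\<close> per step (\<open>exact_step\<close>), and so does the numerical step (\<open>dpg_step_taylor\<close>): the
  exponential Euler part \<open>v + h \<phi>\<^sub>1(h J) F\<close> produces the terms with \<open>F\<close>, \<open>J F\<close> and \<open>J J F\<close>, and the second
  stage, which is the exact solution at time \<open>h/2\<close> up to \<open>O(h\<^sup>2)\<close>, produces \<open>H F F\<close> with the right
  factor by the condition \<open>b\<^sub>2 = 8 \<phi>\<^sub>3\<close>. The Taylor method has Lipschitz constant \<open>1 + L h\<close> near the solution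
  (\<open>taylor_step_lipschitz\<close>), so the errors of at most \<open>T/h\<close> steps add up to \<open>O(h\<^sup>3)\<close> (\<open>global_error\<close>).

  All of this needs the numerical solution to stay in the strip where \<open>F\<close> is smooth. For small \<open>h\<close> the
  error bound itself guarantees that. Only finitely many step sizes \<open>T/N\<close> are not small, and each of
  them determines the numerical solution uniquely (\<open>dpg2_unique\<close>), so enlarging the constant covers them.\<close>

section \<open>Taylor expansion of vector-valued functions\<close>

lemma DERIV_taylor_monomial:
  fixes t :: real
  shows "((\<lambda>t. t ^ Suc k / fact (Suc k)) has_field_derivative t ^ k / fact k) (at t)"
proof -
  have "real (Suc k) * t ^ (Suc k - Suc 0) / fact (Suc k) = t ^ k / fact k"
    unfolding fact_Suc by (simp del: of_nat_Suc)
  then show ?thesis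
    using DERIV_cdivide[OF DERIV_pow[of "Suc k" t UNIV], of "fact (Suc k)"] by (simp only:)
qed

text \<open>The functions \<open>y 0, y 1, \<dots>, y m\<close> are successive derivatives. Giving them as a family, instead of
  iterating a derivative operator, lets the lemma serve for semigroup orbits, for solutions of
  differential equations and for restrictions of \<open>F\<close> to a line: in each case the derivatives are
  known by formula. Differentiability is required in the open interval only, since the solution
  need not be differentiable at the ends of the time interval. The proof integrates the bound for
  the remainder of \<open>y 1\<close>, which is the derivative of the remainder of \<open>y 0\<close>.\<close>

lemma taylor_remainder_bound:
  fixes y :: "nat \<Rightarrow> real \<Rightarrow> 'b::real_normed_vector"
  assumes "0 \<le> h"
    and "\<And>k. k < m \<Longrightarrow> continuous_on {0..h} (y k)"
    and "\<And>k t. \<lbrakk>k < m; 0 < t; t < h\<rbrakk> \<Longrightarrow> (y k has_vector_derivative y (Suc k) t) (at t)"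
    and "\<And>t. \<lbrakk>0 \<le> t; t \<le> h\<rbrakk> \<Longrightarrow> norm (y m t) \<le> K"
  shows "norm (y 0 h - (\<Sum>k<m. (h ^ k / fact k) *\<^sub>R y k 0)) \<le> K * h ^ m / fact m"
  using assms
proof (induction m arbitrary: y h)
  case 0
  then show ?case by simp
next
  case (Suc m)
  define r where "r = (\<lambda>t. y 0 t - (\<Sum>k<Suc m. (t ^ k / fact k) *\<^sub>R y k 0))"
  define r' where "r' = (\<lambda>t. y 1 t - (\<Sum>k<m. (t ^ k / fact k) *\<^sub>R y (Suc k) 0))"
  \<comment> \<open>The constant term is split off, so that the remaining sum can be differentiated term by term.\<close>
  have r_alt: "r = (\<lambda>t. y 0 t - (y 0 0 + (\<Sum>k<m. (t ^ Suc k / fact (Suc k)) *\<^sub>R y (Suc k) 0)))"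
    unfolding r_def by (subst sum.lessThan_Suc_shift) simp
  have r'_le: "norm (r' t) \<le> K * t ^ m / fact m" if t: "0 < t" "t < h" for t
  proof -
    have "norm (y (Suc 0) t - (\<Sum>k<m. (t ^ k / fact k) *\<^sub>R y (Suc k) 0)) \<le> K * t ^ m / fact m"
    proof (rule Suc.IH[of t "\<lambda>k. y (Suc k)"])
      show "continuous_on {0..t} (y (Suc k))" if "k < m" for k
        by (rule continuous_on_subset[OF Suc.prems(2)]) (use that t in auto)
    qed (use Suc.prems t in auto)
    then show ?thesis by (simp add: r'_def)
  qed
  show ?case
  proof (cases "h = 0")
    case True
    then show ?thesis
      unfolding sum.lessThan_Suc_shift by simp
  next
    case False
    have "norm (r h - r 0) \<le> K * h ^ Suc m / fact (Suc m) - K * 0 ^ Suc m / fact (Suc m)"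
    proof (rule differentiable_bound_general[where f' = r' and \<phi>' = "\<lambda>t. K * t ^ m / fact m"])
      show "0 < h" using False Suc.prems(1) by simp
      show "continuous_on {0..h} r"
        unfolding r_def by (intro continuous_intros Suc.prems(2)) auto
      show "(r has_vector_derivative r' t) (at t)" if t: "0 < t" "t < h" for t
      proof -
        have "((\<lambda>t. (t ^ Suc k / fact (Suc k)) *\<^sub>R y (Suc k) 0) has_vector_derivative
            (t ^ k / fact k) *\<^sub>R y (Suc k) 0) (at t)" for k
          by (rule bounded_linear.has_vector_derivative[OF bounded_linear_scaleR_left])
            (use DERIV_taylor_monomial in \<open>simp only: has_real_derivative_iff_has_vector_derivative\<close>)
        then have "((\<lambda>t. y 0 0 + (\<Sum>k<m. (t ^ Suc k / fact (Suc k)) *\<^sub>R y (Suc k) 0)) has_vector_derivative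
            0 + (\<Sum>k<m. (t ^ k / fact k) *\<^sub>R y (Suc k) 0)) (at t)"
          by (intro has_vector_derivative_add has_vector_derivative_const has_vector_derivative_sum)
        from has_vector_derivative_diff[OF Suc.prems(3)[of 0 t] this] t
        show ?thesis
          by (simp add: r_alt r'_def)
      qed
      show "((\<lambda>t. K * t ^ Suc m / fact (Suc m)) has_vector_derivative K * t ^ m / fact m) (at t)" for t
        using DERIV_cmult[OF DERIV_taylor_monomial, of K m t]
        unfolding has_real_derivative_iff_has_vector_derivative[symmetric] by simp
      show "continuous_on {0..h} (\<lambda>t. K * t ^ Suc m / fact (Suc m))"
        by (intro continuous_intros) simp
    qed (use r'_le in simp)
    moreover have "r 0 = 0"
      unfolding r_alt by simp
    ultimately show ?thesis by (simp add: r_def)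
  qed
qed

section \<open>Semigroups with everywhere defined generator\<close>

lemma generates_semigroup:
  assumes "generates A S" "0 \<le> s" "0 \<le> t"
  shows "S (s + t) x = S s (S t x)"
  using assms by (simp add: generates_def C0_semigroup_def)

text \<open>The hypothesis describes the difference quotient at \<open>0\<close> from the right; the semigroup law carries it
  to \<open>t\<close>. From the right one factors out the fixed operator \<open>S t\<close>. From the left the factor is
  \<open>S (t - s)\<close>, which depends on \<open>s\<close>, and the bound \<open>B\<close> keeps it under control: no continuity in
  the operator norm is involved.\<close>

lemma generates_has_vector_derivative:
  assumes gen: "generates A S" and bnd: "\<And>t. \<lbrakk>0 \<le> t; t < b\<rbrakk> \<Longrightarrow> norm (S t) \<le> B" and t: "0 < t" "t < b"
  shows "((\<lambda>t. S t x) has_vector_derivative S t (A x)) (at t)"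
proof -
  define q where "q s = (S s x - x) /\<^sub>R s" for s
  have q: "(q \<longlongrightarrow> A x) (at_right 0)"
    using gen unfolding q_def[abs_def] by (simp add: generates_def)
  have q_eq: "S s x = x + s *\<^sub>R q s" if "s > 0" for s
    using that by (simp add: q_def)
  have cont: "((\<lambda>s. S s (A x)) \<longlongrightarrow> A x) (at_right 0)"
    using gen by (simp add: generates_def C0_semigroup_def)
  let ?R = "\<lambda>s. norm (S (t + s) x - S t x - s *\<^sub>R S t (A x)) / norm s"
  have "(?R \<longlongrightarrow> 0) (at_right 0)"
  proof (rule Lim_transform_eventually)
    show "((\<lambda>s. norm (S t (q s - A x))) \<longlongrightarrow> 0) (at_right 0)"
      by (rule tendsto_eq_intros q | simp)+
    have "?R s = norm (S t (q s - A x))" if "s > 0" for s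
    proof -
      have "S (t + s) x = S t (S s x)"
        by (rule generates_semigroup[OF gen]) (use t that in auto)
      then have "S (t + s) x - S t x - s *\<^sub>R S t (A x) = s *\<^sub>R S t (q s - A x)"
        using q_eq[OF that] by (simp add: blinfun.diff_right blinfun.add_right blinfun.scaleR_right algebra_simps)
      then show ?thesis using that by simp
    qed
    then show "\<forall>\<^sub>F s in at_right 0. norm (S t (q s - A x)) = ?R s"
      by (auto intro!: eventually_at_rightI[of 0 1])
  qed
  moreover have "(?R \<longlongrightarrow> 0) (at_left 0)"
    unfolding filterlim_at_left_to_right
  proof (rule tendsto_sandwich[where f = "\<lambda>_. 0" and h = "\<lambda>s. B * norm (q s - S s (A x))"])
    have "((\<lambda>s. B * norm (q s - S s (A x))) \<longlongrightarrow> B * norm (A x - A x)) (at_right 0)"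
      by (intro tendsto_intros q cont)
    then show "((\<lambda>s. B * norm (q s - S s (A x))) \<longlongrightarrow> 0) (at_right (- 0))" by simp
    have "?R (- s) \<le> B * norm (q s - S s (A x))" if "0 < s" "s < t" for s
    proof -
      have "S t z = S (t - s) (S s z)" for z
        using generates_semigroup[OF gen, of "t - s" s z] that by simp
      then have "S (t - s) x - S t x + s *\<^sub>R S t (A x) = - (s *\<^sub>R S (t - s) (q s - S s (A x)))"
        using q_eq[OF that(1)] by (simp add: blinfun.diff_right blinfun.add_right blinfun.scaleR_right algebra_simps)
      then have "?R (- s) = norm (S (t - s) (q s - S s (A x)))"
        using that by simp
      also have "\<dots> \<le> norm (S (t - s)) * norm (q s - S s (A x))"
        by (rule norm_blinfun)
      also have "\<dots> \<le> B * norm (q s - S s (A x))"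
        using bnd[of "t - s"] that t by (intro mult_right_mono) auto
      finally show ?thesis .
    qed
    then show "\<forall>\<^sub>F s in at_right (- 0). ?R (- s) \<le> B * norm (q s - S s (A x))"
      using t by (auto intro!: eventually_at_rightI[of 0 t])
  qed auto
  ultimately have "(?R \<longlongrightarrow> 0) (at 0)"
    by (simp add: filterlim_at_split)
  then show ?thesis
    by (simp add: has_vector_derivative_def has_derivative_at bounded_linear_scaleR_left)
qed

lemma generates_continuous_on:
  assumes gen: "generates A S" and bnd: "\<And>t. \<lbrakk>0 \<le> t; t < b\<rbrakk> \<Longrightarrow> norm (S t) \<le> B" and h: "h < b"
  shows "continuous_on {0..h} (\<lambda>t. S t x)"
proof (clarsimp simp: continuous_on_eq_continuous_within)
  fix t assume t: "0 \<le> t" "t \<le> h"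
  show "continuous (at t within {0..h}) (\<lambda>t. S t x)"
  proof (cases "t = 0")
    case True
    have "((\<lambda>t. S t x) \<longlongrightarrow> x) (at_right 0)" and "S 0 x = x"
      using gen by (simp_all add: generates_def C0_semigroup_def)
    then have "continuous (at 0 within {0..}) (\<lambda>t. S t x)"
      by (simp add: continuous_within at_within_Ici_at_right)
    then show ?thesis
      using True by (auto elim: continuous_within_subset)
  next
    case False
    then have "((\<lambda>t. S t x) has_vector_derivative S t (A x)) (at t)"
      using generates_has_vector_derivative[OF gen bnd, of b t x] t h by simp
    then show ?thesis
      by (rule continuous_at_imp_continuous_at_within[OF has_vector_derivative_continuous])
  qed
qed

lemma norm_blinfun_funpow_le:
  fixes A :: "'a::real_normed_vector \<Rightarrow>\<^sub>L 'a"
  shows "norm ((blinfun_apply A ^^ m) x) \<le> norm A ^ m * norm x"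
proof (induction m)
  case (Suc m)
  have "norm (A ((blinfun_apply A ^^ m) x)) \<le> norm A * norm ((blinfun_apply A ^^ m) x)"
    by (rule norm_blinfun)
  also have "\<dots> \<le> norm A * (norm A ^ m * norm x)"
    by (intro mult_left_mono Suc.IH) simp
  finally show ?case by (simp add: mult.assoc)
qed simp

text \<open>The \<open>k\<close>-th derivative of the orbit of \<open>x\<close> is the orbit of \<open>(A ^ k) x\<close>. As \<open>A\<close> is bounded, this is the
  exponential series with a remainder that is uniform on bounded sets of generators.\<close>

lemma semigroup_taylor:
  assumes gen: "generates A S" and bnd: "\<And>t. \<lbrakk>0 \<le> t; t < b\<rbrakk> \<Longrightarrow> norm (S t) \<le> B" and h: "0 \<le> h" "h < b"
  shows "norm (S h x - (\<Sum>k<m. (h ^ k / fact k) *\<^sub>R (blinfun_apply A ^^ k) x)) \<le> B * norm A ^ m * norm x * h ^ m / fact m"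
proof -
  have S0: "S 0 z = z" for z
    using gen by (simp add: generates_def C0_semigroup_def)
  have "norm (S h ((blinfun_apply A ^^ 0) x) - (\<Sum>k<m. (h ^ k / fact k) *\<^sub>R S 0 ((blinfun_apply A ^^ k) x)))
      \<le> B * norm A ^ m * norm x * h ^ m / fact m"
  proof (rule taylor_remainder_bound[where y = "\<lambda>k t. S t ((blinfun_apply A ^^ k) x)"])
    show "continuous_on {0..h} (\<lambda>t. S t ((blinfun_apply A ^^ k) x))" for k
      by (rule generates_continuous_on[OF gen bnd h(2)])
    show "((\<lambda>t. S t ((blinfun_apply A ^^ k) x)) has_vector_derivative S t ((blinfun_apply A ^^ Suc k) x)) (at t)" if "0 < t" "t < h" for k t
      using generates_has_vector_derivative[OF gen bnd, of b t "(blinfun_apply A ^^ k) x"] that h by simp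
    show "norm (S t ((blinfun_apply A ^^ m) x)) \<le> B * norm A ^ m * norm x" if "0 \<le> t" "t \<le> h" for t
    proof -
      have "norm (S t ((blinfun_apply A ^^ m) x)) \<le> norm (S t) * norm ((blinfun_apply A ^^ m) x)"
        by (rule norm_blinfun)
      also have "\<dots> \<le> B * (norm A ^ m * norm x)"
        using bnd[of t] that h order_trans[OF norm_ge_zero bnd[of t]]
        by (intro mult_mono norm_blinfun_funpow_le) auto
      finally show ?thesis by (simp add: mult.assoc)
    qed
  qed (use h in auto)
  then show ?thesis by (simp add: S0)
qed

section \<open>The phi functions of a bounded generator\<close>

text \<open>Integration by parts raises \<open>q\<close> and lowers \<open>k\<close>, with no boundary terms; this is the Beta integral
  at integer arguments. It identifies the Taylor coefficients \<open>1 / (p + k)!\<close> of \<open>\<phi>\<^sub>p\<close>.\<close>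

lemma has_integral_monomials_beta:
  "((\<lambda>\<theta>::real. (\<theta> ^ q / fact q) * ((1 - \<theta>) ^ k / fact k)) has_integral 1 / fact (Suc q + k)) {0..1}"
proof (induction k arbitrary: q)
  case 0
  have "((\<lambda>\<theta>::real. \<theta> ^ q / fact q) has_integral 1 ^ Suc q / fact (Suc q) - 0 ^ Suc q / fact (Suc q)) {0..1}"
    by (rule fundamental_theorem_of_calculus)
      (simp, rule has_vector_derivative_at_within,
        rule DERIV_taylor_monomial[unfolded has_real_derivative_iff_has_vector_derivative])
  then show ?case by simp
next
  case (Suc k)
  define b where "b \<theta> = (\<theta> ^ Suc q / fact (Suc q)) * ((1 - \<theta>) ^ Suc k / fact (Suc k))" for \<theta> :: real
  have "(b has_field_derivative
      (\<theta> ^ q / fact q) * ((1 - \<theta>) ^ Suc k / fact (Suc k)) - (\<theta> ^ Suc q / fact (Suc q)) * ((1 - \<theta>) ^ k / fact k))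
      (at \<theta>)" for \<theta>
  proof -
    have "((\<lambda>\<theta>. (1 - \<theta>) ^ Suc k / fact (Suc k)) has_field_derivative (1 - \<theta>) ^ k / fact k * (- 1)) (at \<theta>)"
      by (rule DERIV_chain2[OF DERIV_taylor_monomial]) (auto intro!: derivative_eq_intros)
    from DERIV_mult[OF DERIV_taylor_monomial[of q \<theta>] this]
    show ?thesis
      by (simp add: b_def[abs_def] algebra_simps)
  qed
  note b' = this[unfolded has_real_derivative_iff_has_vector_derivative]
  have "((\<lambda>\<theta>. (\<theta> ^ q / fact q) * ((1 - \<theta>) ^ Suc k / fact (Suc k))
      - (\<theta> ^ Suc q / fact (Suc q)) * ((1 - \<theta>) ^ k / fact k)) has_integral b 1 - b 0) {0..1}"
    by (rule fundamental_theorem_of_calculus) (simp, rule has_vector_derivative_at_within, rule b')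
  from has_integral_add[OF this Suc.IH[of "Suc q"]]
  show ?case
    by (simp add: b_def)
qed

lemma phi_integrand_continuous_on:
  assumes gen: "generates A (sg A)" and bnd: "\<And>t. \<lbrakk>0 \<le> t; t < b\<rbrakk> \<Longrightarrow> norm (sg A t) \<le> B"
    and h: "0 \<le> h" "h < b"
  shows "continuous_on {0..1} (\<lambda>\<theta>. (\<theta> ^ q / fact q) *\<^sub>R sg A ((1 - \<theta>) * h) x)"
proof -
  have "continuous_on {0..1} (\<lambda>\<theta>. sg A ((1 - \<theta>) * h) x)"
  proof (rule continuous_on_compose2[OF generates_continuous_on[OF gen bnd h(2)]])
    show "(\<lambda>\<theta>. (1 - \<theta>) * h) ` {0..1} \<subseteq> {0..h}"
      using h by (auto simp: mult_left_le_one_le)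
  qed (auto intro!: continuous_intros)
  moreover have "continuous_on {0..1} (\<lambda>\<theta>::real. \<theta> ^ q / fact q)"
    by (intro continuous_intros) simp
  ultimately show ?thesis
    by (rule continuous_on_scaleR[rotated])
qed

lemma phi_diff:
  fixes A :: "'a::banach \<Rightarrow>\<^sub>L 'a"
  assumes gen: "generates A (sg A)" and bnd: "\<And>t. \<lbrakk>0 \<le> t; t < b\<rbrakk> \<Longrightarrow> norm (sg A t) \<le> B"
    and h: "0 \<le> h" "h < b"
  shows "phi (Suc q) h A (x - y) = phi (Suc q) h A x - phi (Suc q) h A y"
  using phi_integrand_continuous_on[OF gen bnd h, of q]
  by (simp add: phi_def blinfun.diff_right scaleR_diff_right integral_diff integrable_continuous_real)

text \<open>The identity \<open>e\<^sup>z = 1 + z \<phi>\<^sub>1(z)\<close>: the integrand of \<open>phi 1 h A (A x)\<close> is, up to the factor \<open>- h\<close>, the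
  derivative of \<open>\<theta> \<mapsto> S ((1 - \<theta>) h) x\<close>.\<close>

lemma sg_eq_phi_1:
  fixes A :: "'a::banach \<Rightarrow>\<^sub>L 'a"
  assumes gen: "generates A (sg A)" and bnd: "\<And>t. \<lbrakk>0 \<le> t; t < b\<rbrakk> \<Longrightarrow> norm (sg A t) \<le> B"
    and h: "0 \<le> h" "h < b"
  shows "sg A h x = x + h *\<^sub>R phi 1 h A (A x)"
proof -
  have S0: "sg A 0 x = x"
    using gen by (simp add: generates_def C0_semigroup_def)
  have c: "continuous_on {0..1} (\<lambda>\<theta>. sg A ((1 - \<theta>) * h) y)" for y
    using phi_integrand_continuous_on[OF gen bnd h, of 0] by simp
  show ?thesis
  proof (cases "h = 0")
    case False
    then have "h > 0" using h by simp
    have "((\<lambda>\<theta>. (- h) *\<^sub>R sg A ((1 - \<theta>) * h) (A x)) has_integral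
        sg A ((1 - 1) * h) x - sg A ((1 - 0) * h) x) {0..1}"
    proof (rule fundamental_theorem_of_calculus_interior)
      fix \<theta> :: real assume "\<theta> \<in> {0<..<1}"
      then have \<theta>: "0 < (1 - \<theta>) * h" "(1 - \<theta>) * h < b"
        using \<open>h > 0\<close> h by (auto intro!: order.strict_trans1[OF mult_left_le_one_le])
      have "((\<lambda>\<theta>. (1 - \<theta>) * h) has_vector_derivative - h) (at \<theta>)"
        unfolding has_real_derivative_iff_has_vector_derivative[symmetric]
        by (auto intro!: derivative_eq_intros)
      from vector_diff_chain_at[OF this generates_has_vector_derivative[OF gen bnd \<theta>]]
      show "((\<lambda>\<theta>. sg A ((1 - \<theta>) * h) x) has_vector_derivative (- h) *\<^sub>R sg A ((1 - \<theta>) * h) (A x)) (at \<theta>)"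
        by (simp add: o_def)
    qed (use c in auto)
    from integral_unique[OF this]
    have "(- h) *\<^sub>R integral {0..1} (\<lambda>\<theta>. sg A ((1 - \<theta>) * h) (A x)) = x - sg A h x"
      unfolding integral_cmul by (simp add: S0)
    then show ?thesis
      by (simp add: phi_def algebra_simps)
  qed (simp add: S0)
qed

text \<open>Substitute the expansion of the semigroup under the integral; the weight \<open>\<theta> ^ q / q!\<close> is at most
  \<open>1\<close>, so the remainder is not enlarged.\<close>

lemma phi_taylor:
  fixes A :: "'a::banach \<Rightarrow>\<^sub>L 'a"
  assumes gen: "generates A (sg A)" and bnd: "\<And>t. \<lbrakk>0 \<le> t; t < b\<rbrakk> \<Longrightarrow> norm (sg A t) \<le> B"
    and h: "0 \<le> h" "h < b"
  shows "norm (phi (Suc q) h A x - (\<Sum>k<m. (h ^ k / fact (Suc q + k)) *\<^sub>R (blinfun_apply A ^^ k) x))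
    \<le> B * norm A ^ m * norm x * h ^ m / fact m"
proof -
  have B: "0 \<le> B"
    using order_trans[OF norm_ge_zero bnd[of 0]] h by simp
  define w :: "real \<Rightarrow> real" where "w \<theta> = \<theta> ^ q / fact q" for \<theta>
  define P where "P t = (\<Sum>k<m. (t ^ k / fact k) *\<^sub>R (blinfun_apply A ^^ k) x)" for t :: real
  define E where "E = B * norm A ^ m * norm x * h ^ m / fact m"
  have E: "0 \<le> E"
    using B h by (simp add: E_def)
  have "((\<lambda>\<theta>. w \<theta> *\<^sub>R sg A ((1 - \<theta>) * h) x) has_integral phi (Suc q) h A x) {0..1}"
    using integrable_integral[OF integrable_continuous_real[OF phi_integrand_continuous_on[OF gen bnd h]]]
    by (simp add: w_def phi_def)
  moreover have "((\<lambda>\<theta>. w \<theta> *\<^sub>R P ((1 - \<theta>) * h)) has_integral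
      (\<Sum>k<m. (h ^ k / fact (Suc q + k)) *\<^sub>R (blinfun_apply A ^^ k) x)) {0..1}"
  proof -
    have "((\<lambda>\<theta>. (h ^ k * (w \<theta> * ((1 - \<theta>) ^ k / fact k))) *\<^sub>R (blinfun_apply A ^^ k) x) has_integral
        (h ^ k * (1 / fact (Suc q + k))) *\<^sub>R (blinfun_apply A ^^ k) x) {0..1}" for k
      unfolding w_def
      by (intro has_integral_scaleR_left has_integral_mult_right has_integral_monomials_beta)
    from has_integral_sum[OF finite_lessThan[of m] this]
    show ?thesis
      by (simp add: P_def scaleR_sum_right power_mult_distrib mult_ac)
  qed
  ultimately have "((\<lambda>\<theta>. w \<theta> *\<^sub>R sg A ((1 - \<theta>) * h) x - w \<theta> *\<^sub>R P ((1 - \<theta>) * h)) has_integral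
      phi (Suc q) h A x - (\<Sum>k<m. (h ^ k / fact (Suc q + k)) *\<^sub>R (blinfun_apply A ^^ k) x)) {0..1}"
    by (rule has_integral_diff)
  then have "norm (phi (Suc q) h A x - (\<Sum>k<m. (h ^ k / fact (Suc q + k)) *\<^sub>R (blinfun_apply A ^^ k) x))
      \<le> E * measure lborel {0..1::real}"
  proof (rule has_integral_bound_real[OF E finite.emptyI])
    fix \<theta> :: real assume "\<theta> \<in> {0..1} - {}"
    then have \<theta>: "\<theta> \<in> {0..1}" by simp
    have t: "0 \<le> (1 - \<theta>) * h" "(1 - \<theta>) * h \<le> h"
      using \<theta> h by (auto simp: mult_left_le_one_le)
    have w: "0 \<le> w \<theta>" "w \<theta> \<le> 1"
      using \<theta> power_le_one[of \<theta> q] fact_ge_1[of q, where 'a = real]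
      by (auto simp: w_def divide_le_eq_1 intro: order_trans)
    have "norm (sg A ((1 - \<theta>) * h) x - P ((1 - \<theta>) * h)) \<le> B * norm A ^ m * norm x * ((1 - \<theta>) * h) ^ m / fact m"
      unfolding P_def by (rule semigroup_taylor[OF gen bnd]) (use t h in auto)
    also have "\<dots> \<le> E"
      unfolding E_def using t B by (intro divide_right_mono mult_left_mono power_mono) auto
    finally have "w \<theta> * norm (sg A ((1 - \<theta>) * h) x - P ((1 - \<theta>) * h)) \<le> 1 * E"
      using w E by (intro mult_mono) auto
    then show "norm (w \<theta> *\<^sub>R sg A ((1 - \<theta>) * h) x - w \<theta> *\<^sub>R P ((1 - \<theta>) * h)) \<le> E"
      using w by (simp flip: scaleR_diff_right)
  qed
  then show ?thesis
    by (simp add: E_def)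
qed

section \<open>Smooth vector fields along a solution\<close>

lemma norm_blinfun_apply_le:
  assumes "norm f \<le> a" "norm x \<le> b"
  shows "norm (blinfun_apply f x) \<le> a * b"
proof -
  have "norm (f x) \<le> norm f * norm x" by (rule norm_blinfun)
  also have "\<dots> \<le> a * b"
    using assms order_trans[OF norm_ge_zero assms(1)] by (intro mult_mono) auto
  finally show ?thesis .
qed

lemma norm_scaleR_le:
  fixes x :: "'a::real_normed_vector"
  shows "\<lbrakk>0 \<le> c; norm x \<le> b\<rbrakk> \<Longrightarrow> norm (c *\<^sub>R x) \<le> c * b"
  by (simp add: mult_left_mono)

lemma norm_blinfun_apply_diff_le:
  assumes "norm (f - g) \<le> a'" "norm x \<le> b" "norm g \<le> a" "norm (x - y) \<le> b'"
  shows "norm (blinfun_apply f x - blinfun_apply g y) \<le> a' * b + a * b'"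
proof -
  have "blinfun_apply f x - blinfun_apply g y = (f - g) x + g (x - y)"
    by (simp add: blinfun.diff_left blinfun.diff_right)
  then show ?thesis
    using norm_triangle_mono[OF norm_blinfun_apply_le[OF assms(1,2)] norm_blinfun_apply_le[OF assms(3,4)]]
    by simp
qed

lemma fderiv_lipschitz_on_ball:
  assumes "\<And>z. z \<in> ball c R \<Longrightarrow> f differentiable (at z)" "\<And>z. z \<in> ball c R \<Longrightarrow> norm (fderiv f z) \<le> M"
    and "v \<in> ball c R" "w \<in> ball c R"
  shows "norm (f v - f w) \<le> M * norm (v - w)"
proof (rule differentiable_bound[OF convex_ball])
  show "(f has_derivative fderiv f z) (at z within ball c R)" if "z \<in> ball c R" for z
    by (rule has_derivative_at_withinI[OF has_derivative_fderiv[OF assms(1)[OF that]]])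
  show "onorm (fderiv f z) \<le> M" if "z \<in> ball c R" for z
    using assms(2)[OF that] by (simp add: norm_blinfun.rep_eq)
qed (use assms in auto)

lemma has_vector_derivative_fderiv:
  assumes "f differentiable (at (c t))" "(c has_vector_derivative c') (at t)"
  shows "((\<lambda>t. f (c t)) has_vector_derivative fderiv f (c t) c') (at t)"
  using vector_derivative_diff_chain_within[of c c' t UNIV f "fderiv f (c t)"]
    has_derivative_at_withinI[OF has_derivative_fderiv[OF assms(1)]] assms(2)
  by (simp add: o_def)

text \<open>One constant \<open>M\<close> bounds everything in the strip: the vector field, its three derivatives and the
  semigroups of its Jacobians. The semigroup bound is wanted for times up to and including \<open>T\<close>, with
  some room beyond \<open>T\<close> because orbits are differentiated in the interior of their time interval; \<open>2 * T\<close>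
  is a convenient choice.\<close>

locale smooth_ode =
  fixes F :: "'a::banach \<Rightarrow> 'a" and u :: "real \<Rightarrow> 'a" and T R M :: real
  assumes T_pos: "0 < T" and R_pos: "0 < R" and M_ge_1: "1 \<le> M"
    and u_cont: "continuous_on {0..T} u"
    and u_ode: "\<And>t. \<lbrakk>0 < t; t < T\<rbrakk> \<Longrightarrow> (u has_vector_derivative F (u t)) (at t)"
    and smooth: "\<And>v. v \<in> strip u T R \<Longrightarrow> F differentiable (at v)"
      "\<And>v. v \<in> strip u T R \<Longrightarrow> fderiv F differentiable (at v)"
      "\<And>v. v \<in> strip u T R \<Longrightarrow> fderiv (fderiv F) differentiable (at v)"
    and bounds: "\<And>v. v \<in> strip u T R \<Longrightarrow> norm (F v) \<le> M"
      "\<And>v. v \<in> strip u T R \<Longrightarrow> norm (fderiv F v) \<le> M"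
      "\<And>v. v \<in> strip u T R \<Longrightarrow> norm (fderiv (fderiv F) v) \<le> M"
      "\<And>v. v \<in> strip u T R \<Longrightarrow> norm (fderiv (fderiv (fderiv F)) v) \<le> M"
    and generates_sg: "\<And>v. v \<in> strip u T R \<Longrightarrow> generates (fderiv F v) (sg (fderiv F v))"
    and sg_bound: "\<And>v t. \<lbrakk>v \<in> strip u T R; 0 \<le> t; t < 2 * T\<rbrakk> \<Longrightarrow> norm (sg (fderiv F v) t) \<le> M"
begin

abbreviation "J \<equiv> fderiv F"
abbreviation "H \<equiv> fderiv (fderiv F)"
abbreviation "K \<equiv> fderiv (fderiv (fderiv F))"

text \<open>If \<open>y' = F y\<close>, then the second, third and fourth derivatives of \<open>y\<close> are \<open>D2 y\<close>, \<open>D3 y\<close> and \<open>D4 y\<close>.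
  The two occurrences of \<open>H v (F v) (D2 v)\<close> in \<open>D4\<close> come from different terms of the product rule.\<close>

definition "D2 v = J v (F v)"
definition "D3 v = J v (D2 v) + H v (F v) (F v)"
definition "D4 v = (J v (D3 v) + H v (F v) (D2 v)) + (H v (F v) (D2 v) + (H v (D2 v) + K v (F v) (F v)) (F v))"

text \<open>The third-order Taylor method. It is the common reference for the exact flow and for the
  numerical step, which both differ from it by \<open>O(h\<^sup>4)\<close> in one step.\<close>

definition "taylor_step h v = v + h *\<^sub>R F v + (h ^ 2 / 2) *\<^sub>R D2 v + (h ^ 3 / 6) *\<^sub>R D3 v"

lemma M_nonneg: "0 \<le> M" using M_ge_1 by simp

lemma ball_subset_strip: "t \<in> {0..T} \<Longrightarrow> ball (u t) R \<subseteq> strip u T R"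
  by (auto simp: strip_def)

lemma u_in_strip: "t \<in> {0..T} \<Longrightarrow> u t \<in> strip u T R"
  using ball_subset_strip R_pos by force

lemma norm_D2_le: "v \<in> strip u T R \<Longrightarrow> norm (D2 v) \<le> M ^ 2"
  unfolding D2_def power2_eq_square by (intro norm_blinfun_apply_le bounds)

lemma norm_D3_le: "v \<in> strip u T R \<Longrightarrow> norm (D3 v) \<le> 2 * M ^ 3"
proof -
  assume v: "v \<in> strip u T R"
  have "norm (D3 v) \<le> M * M ^ 2 + M * M * M"
    unfolding D3_def by (intro norm_triangle_mono norm_blinfun_apply_le bounds norm_D2_le v)
  then show ?thesis by (simp add: power2_eq_square power3_eq_cube)
qed

lemma norm_D4_le: "v \<in> strip u T R \<Longrightarrow> norm (D4 v) \<le> 6 * M ^ 4"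
proof -
  assume v: "v \<in> strip u T R"
  have "norm (D4 v) \<le> (M * (2 * M ^ 3) + M * M * M ^ 2) + (M * M * M ^ 2 + (M * M ^ 2 + M * M * M) * M)"
    unfolding D4_def by (intro norm_triangle_mono norm_blinfun_apply_le bounds norm_D2_le norm_D3_le v)
  then show ?thesis by (simp add: eval_nat_numeral algebra_simps)
qed

lemma exact_step:
  assumes t: "0 \<le> t" and h: "0 \<le> h" "t + h \<le> T"
  shows "norm (u (t + h) - taylor_step h (u t)) \<le> M ^ 4 * h ^ 4"
proof -
  define y :: "nat \<Rightarrow> real \<Rightarrow> 'a" where
    "y k = [u, \<lambda>s. F (u s), \<lambda>s. D2 (u s), \<lambda>s. D3 (u s), \<lambda>s. D4 (u s)] ! k" for k
  have y: "y 0 = u" "y 1 = (\<lambda>s. F (u s))" "y 2 = (\<lambda>s. D2 (u s))" "y 3 = (\<lambda>s. D3 (u s))" "y 4 = (\<lambda>s. D4 (u s))"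
    by (simp_all add: y_def)
  have less4: "k = 0 \<or> k = 1 \<or> k = 2 \<or> k = 3" if "k < 4" for k :: nat
    using that by arith
  have cu: "continuous_on {0..T} (\<lambda>s. f (u s))"
    if "\<And>v. v \<in> strip u T R \<Longrightarrow> f differentiable (at v)" for f :: "'a \<Rightarrow> 'b::real_normed_vector"
    by (rule continuous_on_compose2[OF _ u_cont, of "u ` {0..T}"])
      (auto intro!: continuous_at_imp_continuous_on differentiable_imp_continuous_within that u_in_strip)
  note c = cu[OF smooth(1)] cu[OF smooth(2)] cu[OF smooth(3)]
  have cont: "continuous_on {0..T} (y k)" if "k < 4" for k
    using less4[OF that]
    by (auto simp: y D2_def D3_def intro!: continuous_intros blinfun.continuous_on u_cont c simp del: One_nat_def)
  have deriv: "(y k has_vector_derivative y (Suc k) s) (at s)" if "k < 4" "0 < s" "s < T" for k s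
  proof -
    have us: "u s \<in> strip u T R"
      using that by (intro u_in_strip) auto
    note f = has_vector_derivative_fderiv[of _ u s, OF _ u_ode[OF that(2,3)]]
    have d1: "((\<lambda>s. F (u s)) has_vector_derivative D2 (u s)) (at s)"
      unfolding D2_def by (rule f[OF smooth(1)[OF us]])
    have d2: "((\<lambda>s. D2 (u s)) has_vector_derivative D3 (u s)) (at s)"
      using blinfun.has_vector_derivative[OF f[OF smooth(2)[OF us]] d1]
      by (simp add: D3_def D2_def)
    have hf: "((\<lambda>s. H (u s) (F (u s))) has_vector_derivative H (u s) (D2 (u s)) + K (u s) (F (u s)) (F (u s))) (at s)"
      by (rule blinfun.has_vector_derivative[OF f[OF smooth(3)[OF us]] d1])
    have d3: "((\<lambda>s. D3 (u s)) has_vector_derivative D4 (u s)) (at s)"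
      unfolding D3_def D4_def
      by (rule has_vector_derivative_add[OF
            blinfun.has_vector_derivative[OF f[OF smooth(2)[OF us]] d2]
            blinfun.has_vector_derivative[OF hf d1], unfolded D3_def])
    from less4[OF that(1)] show ?thesis
      using d1 d2 d3 u_ode[OF that(2,3)] by (auto simp: y_def numeral_eq_Suc)
  qed
  have "norm (y 0 (t + h) - (\<Sum>k<4. (h ^ k / fact k) *\<^sub>R y k (t + 0))) \<le> 6 * M ^ 4 * h ^ 4 / fact 4"
  proof (rule taylor_remainder_bound[where y = "\<lambda>k s. y k (t + s)"])
    show "continuous_on {0..h} (\<lambda>s. y k (t + s))" if "k < 4" for k
      by (rule continuous_on_compose2[OF cont[OF that]]) (use t h in \<open>auto intro!: continuous_intros\<close>)
    show "((\<lambda>s. y k (t + s)) has_vector_derivative y (Suc k) (t + s)) (at s)" if "k < 4" "0 < s" "s < h" for k s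
    proof -
      have "((\<lambda>s. t + s) has_vector_derivative 1) (at s)"
        unfolding has_real_derivative_iff_has_vector_derivative[symmetric]
        by (auto intro!: derivative_eq_intros)
      from vector_diff_chain_at[OF this deriv[OF that(1), of "t + s"]] that t h
      show ?thesis by (simp add: o_def)
    qed
    show "norm (y 4 (t + s)) \<le> 6 * M ^ 4" if "0 \<le> s" "s \<le> h" for s
      unfolding y by (rule norm_D4_le[OF u_in_strip]) (use that t h in auto)
  qed (use h in auto)
  moreover have "(\<Sum>k<4. (h ^ k / fact k) *\<^sub>R y k (t + 0)) = taylor_step h (u t)"
    by (simp add: eval_nat_numeral taylor_step_def y_def)
  moreover have "6 * M ^ 4 * h ^ 4 / fact 4 \<le> M ^ 4 * h ^ 4"
    using M_nonneg h by (simp add: fact_numeral)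
  ultimately show ?thesis by (simp add: y)
qed

definition "L = M + T * M ^ 2 + T ^ 2 * M ^ 3"

lemma L_nonneg: "0 \<le> L"
  using M_nonneg T_pos by (simp add: L_def)

text \<open>Every term of \<open>taylor_step\<close> after the first carries a factor \<open>h\<close> and is a product of bounded Lipschitz
  functions, so errors are amplified by at most \<open>1 + L h\<close> in one step. Comparing with a point of the
  solution keeps both arguments in one ball, where the mean value inequality applies; the strip
  may fail to be convex.\<close>

lemma taylor_step_lipschitz:
  assumes t: "t \<in> {0..T}" and v: "v \<in> ball (u t) R" and h: "0 \<le> h" "h \<le> T"
  shows "norm (taylor_step h v - taylor_step h (u t)) \<le> (1 + L * h) * norm (v - u t)"
proof -
  define w where "w = u t"
  define d where "d = norm (v - w)"
  have d: "0 \<le> d" by (simp add: d_def)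
  have vw: "v \<in> strip u T R" "w \<in> strip u T R" and w: "w \<in> ball (u t) R"
    using ball_subset_strip[OF t] v R_pos by (auto simp: w_def)
  have sub: "z \<in> ball (u t) R \<Longrightarrow> z \<in> strip u T R" for z
    using ball_subset_strip[OF t] by auto
  note lip = fderiv_lipschitz_on_ball[OF _ _ v w, of _ M, folded d_def]
  have F: "norm (F v - F w) \<le> M * d"
    by (rule lip) (auto intro!: smooth bounds sub)
  have J: "norm (J v - J w) \<le> M * d"
    by (rule lip) (auto intro!: smooth bounds sub)
  have H: "norm (H v - H w) \<le> M * d"
    by (rule lip) (auto intro!: smooth bounds sub)
  have D2: "norm (D2 v - D2 w) \<le> (M * d) * M + M * (M * d)"
    unfolding D2_def by (intro norm_blinfun_apply_diff_le F J bounds vw)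
  have HF: "norm (H v (F v) - H w (F w)) \<le> (M * d) * M + M * (M * d)"
    by (intro norm_blinfun_apply_diff_le F H bounds vw)
  have "norm ((J v (D2 v) - J w (D2 w)) + (H v (F v) (F v) - H w (F w) (F w)))
      \<le> ((M * d) * M ^ 2 + M * ((M * d) * M + M * (M * d)))
        + (((M * d) * M + M * (M * d)) * M + (M * M) * (M * d))"
    by (intro norm_triangle_mono norm_blinfun_apply_diff_le norm_blinfun_apply_le norm_D2_le F J D2 HF bounds vw)
  then have D3: "norm (D3 v - D3 w) \<le> 6 * M ^ 3 * d"
    by (simp add: D3_def algebra_simps eval_nat_numeral)
  have "taylor_step h v - taylor_step h w = (v - w) + h *\<^sub>R (F v - F w)
      + (h ^ 2 / 2) *\<^sub>R (D2 v - D2 w) + (h ^ 3 / 6) *\<^sub>R (D3 v - D3 w)"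
    by (simp add: taylor_step_def algebra_simps)
  also have "norm \<dots> \<le> d + h * (M * d) + (h ^ 2 / 2) * ((M * d) * M + M * (M * d)) + (h ^ 3 / 6) * (6 * M ^ 3 * d)"
    using h F D2 D3 by (intro norm_triangle_mono norm_scaleR_le) (auto simp: d_def)
  also have "\<dots> = (1 + (M + h * M ^ 2 + h ^ 2 * M ^ 3) * h) * d"
    by (simp add: algebra_simps eval_nat_numeral)
  also have "\<dots> \<le> (1 + L * h) * d"
    unfolding L_def using h M_nonneg d
    by (intro mult_right_mono add_mono order_refl power_mono) auto
  finally show ?thesis by (simp add: d_def w_def)
qed

end

section \<open>Consistency of the numerical step\<close>

context smooth_ode
begin

lemma F_second_order:
  assumes t: "t \<in> {0..T}" and v: "v \<in> ball (u t) R" and vd: "v + d \<in> ball (u t) R"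
  shows "norm (F (v + d) - (F v + J v d + (1 / 2) *\<^sub>R H v d d)) \<le> M * norm d ^ 3 / 6"
proof -
  define y :: "nat \<Rightarrow> real \<Rightarrow> 'a" where
    "y k = [\<lambda>s. F (v + s *\<^sub>R d), \<lambda>s. J (v + s *\<^sub>R d) d, \<lambda>s. H (v + s *\<^sub>R d) d d, \<lambda>s. K (v + s *\<^sub>R d) d d d] ! k" for k
  have less3: "k = 0 \<or> k = 1 \<or> k = 2" if "k < 3" for k :: nat
    using that by arith
  have inside: "v + s *\<^sub>R d \<in> strip u T R" if "0 \<le> s" "s \<le> 1" for s
  proof -
    have "(1 - s) *\<^sub>R v + s *\<^sub>R (v + d) \<in> ball (u t) R"
      using that by (intro convexD_alt[OF convex_ball v vd])
    then have "v + s *\<^sub>R d \<in> ball (u t) R"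
      by (simp add: algebra_simps)
    then show ?thesis using ball_subset_strip[OF t] by auto
  qed
  have deriv: "(y k has_vector_derivative y (Suc k) s) (at s)" if "k < 3" "0 \<le> s" "s \<le> 1" for k s
  proof -
    note i = inside[OF that(2,3)]
    have line: "((\<lambda>s. v + s *\<^sub>R d) has_vector_derivative d) (at s)"
      by (auto intro!: derivative_eq_intros)
    note f = has_vector_derivative_fderiv[of _ "\<lambda>s. v + s *\<^sub>R d", OF _ line]
    note ap = bounded_linear.has_vector_derivative[OF blinfun.bounded_linear_left]
    from less3[OF that(1)] show ?thesis
      using f[OF smooth(1)[OF i]] ap[OF f[OF smooth(2)[OF i]], of d] ap[OF ap[OF f[OF smooth(3)[OF i]]], of d d]
      by (auto simp: y_def numeral_eq_Suc)
  qed
  have "norm (y 0 1 - (\<Sum>k<3. (1 ^ k / fact k) *\<^sub>R y k 0)) \<le> M * norm d * norm d * norm d * 1 ^ 3 / fact 3"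
  proof (rule taylor_remainder_bound)
    show "continuous_on {0..1} (y k)" if "k < 3" for k
      using deriv[OF that] by (auto intro!: continuous_at_imp_continuous_on has_vector_derivative_continuous[of "y k" "y (Suc k) _"])
    show "norm (y 3 s) \<le> M * norm d * norm d * norm d" if "0 \<le> s" "s \<le> 1" for s
    proof -
      have "norm (K (v + s *\<^sub>R d) d d d) \<le> M * norm d * norm d * norm d"
        by (intro norm_blinfun_apply_le bounds inside that order_refl)
      then show ?thesis by (simp add: y_def)
    qed
  qed (use deriv in auto)
  then show ?thesis
    by (simp add: y_def eval_nat_numeral fact_numeral add.assoc)
qed

text \<open>One step of the method after the coefficients have been eliminated by the order conditions
  \<open>b\<^sub>1 + b\<^sub>2 = \<phi>\<^sub>1\<close> and \<open>b\<^sub>2 = 8 \<phi>\<^sub>3\<close>.\<close>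

definition "dpg_step h v =
  (let A = J v; g = (\<lambda>w. F w - blinfun_apply A w); d = h *\<^sub>R phi 2 h A (F v)
   in sg A h v + h *\<^sub>R phi 1 h A (g v) + (8 * h) *\<^sub>R phi 3 h A (g (v + d) - g v))"

definition "C_loc = M ^ 5 + 8 * M ^ 9 * (1 + 2 * T) + 3 * M ^ 7"

text \<open>With \<open>e\<^sup>z v + h \<phi>\<^sub>1(z) (F v - A v) = v + h \<phi>\<^sub>1(z) F v\<close> for \<open>z = h A\<close>, the first three terms of
  \<open>\<phi>\<^sub>1\<close> yield all of \<open>taylor_step\<close> except \<open>(h\<^sup>3 / 6) H v (F v) (F v)\<close>. That part comes from the second
  stage: as \<open>\<phi>\<^sub>2(0) = 1 / 2\<close>, the increment is \<open>d = (h / 2) F v + O(h\<^sup>2)\<close>. The linear parts of \<open>g (v + d) - g v\<close>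
  cancel, because \<open>A\<close> is the exact Jacobian, and \<open>(1 / 2) H v d d = (h\<^sup>2 / 8) H v (F v) (F v) + O(h\<^sup>3)\<close> remains.
  Finally \<open>8 h \<phi>\<^sub>3(0) = 8 h / 6\<close> turns \<open>h\<^sup>2 / 8\<close> into \<open>h\<^sup>3 / 6\<close>: this is what the factor \<open>1 / 8\<close> in the order
  condition is for. The condition \<open>M\<^sup>2 h \<le> R / 2\<close> keeps the second stage inside the strip.\<close>

lemma dpg_step_taylor:
  assumes t: "t \<in> {0..T}" and v: "v \<in> ball (u t) (R / 2)" and h: "0 \<le> h" "h \<le> T" "M ^ 2 * h \<le> R / 2"
  shows "norm (dpg_step h v - taylor_step h v) \<le> C_loc * h ^ 4"
proof -
  define A where "A = J v"
  define g where "g w = F w - A w" for w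
  define d where "d = h *\<^sub>R phi 2 h A (F v)"
  define f where "f = (h / 2) *\<^sub>R F v"
  define w where "w = g (v + d) - g v"
  have M: "0 \<le> M" "1 \<le> M" by (rule M_nonneg, rule M_ge_1)
  have vR: "v \<in> ball (u t) R" using v R_pos by simp
  then have vs: "v \<in> strip u T R" using ball_subset_strip[OF t] by auto
  have gen: "generates A (sg A)" unfolding A_def by (rule generates_sg[OF vs])
  have sgb: "norm (sg A s) \<le> M" if "0 \<le> s" "s < 2 * T" for s
    unfolding A_def by (rule sg_bound[OF vs that])
  have h': "h < 2 * T" using h T_pos by simp
  note pt = phi_taylor[OF gen sgb h(1) h']
  have nA: "norm A \<le> M" unfolding A_def by (rule bounds[OF vs])
  have nF: "norm (F v) \<le> M" by (rule bounds[OF vs])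
  have nH: "norm (H v) \<le> M" by (rule bounds[OF vs])
  have pt': "norm (phi (Suc q) h A x - (\<Sum>k<m. (h ^ k / fact (Suc q + k)) *\<^sub>R (blinfun_apply A ^^ k) x))
      \<le> M * M ^ m * b * h ^ m" if "norm x \<le> b" for q m x b
  proof -
    have b: "0 \<le> b" using that norm_ge_zero order_trans by blast
    have "M * norm A ^ m * norm x * h ^ m / fact m \<le> M * norm A ^ m * norm x * h ^ m / 1"
      using M h fact_ge_1[of m, where 'a = real] by (intro divide_left_mono) auto
    also have "\<dots> \<le> M * M ^ m * b * h ^ m"
      using M h nA that b by (auto intro!: mult_mono power_mono)
    finally show ?thesis using pt[of q x m] by linarith
  qed
  have "norm (phi 1 h A (F v) - (F v + (h / 2) *\<^sub>R D2 v + (h ^ 2 / 6) *\<^sub>R A (D2 v))) \<le> M ^ 5 * h ^ 3"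
    using pt'[OF nF, of 0 3] by (simp add: eval_nat_numeral fact_numeral D2_def A_def add.assoc mult_ac)
  then have 1: "norm (h *\<^sub>R (phi 1 h A (F v) - (F v + (h / 2) *\<^sub>R D2 v + (h ^ 2 / 6) *\<^sub>R A (D2 v)))) \<le> h * (M ^ 5 * h ^ 3)"
    by (rule norm_scaleR_le[OF h(1)])
  have "norm (phi 2 h A (F v)) \<le> M ^ 2"
    using pt'[OF nF, of 1 0, unfolded Suc_1] by (simp add: power2_eq_square)
  then have nd: "norm d \<le> h * M ^ 2"
    unfolding d_def by (rule norm_scaleR_le[OF h(1)])
  have "norm (phi 2 h A (F v) - (1 / 2) *\<^sub>R F v) \<le> M ^ 3 * h"
    using pt'[OF nF, of 1 1, unfolded Suc_1] by (simp add: power3_eq_cube)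
  then have "norm (h *\<^sub>R (phi 2 h A (F v) - (1 / 2) *\<^sub>R F v)) \<le> h * (M ^ 3 * h)"
    by (rule norm_scaleR_le[OF h(1)])
  then have df: "norm (d - f) \<le> M ^ 3 * h ^ 2"
    by (simp add: d_def f_def scaleR_diff_right power2_eq_square mult_ac)
  have nf: "norm f \<le> h * M ^ 2"
  proof -
    have "norm f \<le> (h / 2) * M"
      unfolding f_def using h by (intro norm_scaleR_le nF) auto
    also have "\<dots> \<le> h * M ^ 2"
      using h power_increasing[of 1 2 M] M by (intro mult_mono) auto
    finally show ?thesis .
  qed
  \<comment> \<open>The radius \<open>R / 2\<close> for \<open>v\<close> leaves room for the stage increment.\<close>
  have vd: "v + d \<in> ball (u t) R"
  proof -
    have "norm (u t - (v + d)) \<le> norm (u t - v) + norm d"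
      using norm_triangle_ineq4[of "u t - v" d] by (simp add: algebra_simps)
    then show ?thesis
      using v nd h(3) by (simp add: dist_norm mult.commute)
  qed
  have "norm (w - (1 / 2) *\<^sub>R H v d d) \<le> M * norm d ^ 3 / 6"
    using F_second_order[OF t vR vd] by (simp add: w_def g_def A_def blinfun.add_right algebra_simps)
  also have "\<dots> \<le> M * (h * M ^ 2) ^ 3 / 6"
    using M nd by (intro divide_right_mono mult_left_mono power_mono) auto
  also have "\<dots> = M ^ 7 * h ^ 3 / 6"
    by (simp add: power_mult_distrib flip: power_mult) (simp add: eval_nat_numeral)
  finally have w1: "norm (w - (1 / 2) *\<^sub>R H v d d) \<le> M ^ 7 * h ^ 3 / 6" .
  have "norm (H v d d - H v f f) \<le> (M * (M ^ 3 * h ^ 2)) * (h * M ^ 2) + (M * (h * M ^ 2)) * (M ^ 3 * h ^ 2)"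
    using norm_blinfun_apply_le[OF nH df]
    by (intro norm_blinfun_apply_diff_le nd df norm_blinfun_apply_le nH nf) (simp add: blinfun.diff_right)
  also have "\<dots> = 2 * (M ^ 6 * h ^ 3)"
    by (simp add: eval_nat_numeral algebra_simps)
  finally have "norm ((1 / 2) *\<^sub>R (H v d d - H v f f)) \<le> (1 / 2) * (2 * (M ^ 6 * h ^ 3))"
    by (intro norm_scaleR_le) auto
  then have w2: "norm ((1 / 2) *\<^sub>R (H v d d - H v f f)) \<le> M ^ 6 * h ^ 3" by simp
  have "M ^ 6 * h ^ 3 \<le> M ^ 7 * h ^ 3"
    using M h by (intro mult_right_mono power_increasing) auto
  moreover have "0 \<le> M ^ 7 * h ^ 3" using M h by simp
  moreover have w_eq: "w - (h ^ 2 / 8) *\<^sub>R H v (F v) (F v) = (w - (1 / 2) *\<^sub>R H v d d) + (1 / 2) *\<^sub>R (H v d d - H v f f)"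
    by (simp add: f_def blinfun.scaleR_right blinfun.scaleR_left power2_eq_square algebra_simps)
  ultimately have w: "norm (w - (h ^ 2 / 8) *\<^sub>R H v (F v) (F v)) \<le> 2 * M ^ 7 * h ^ 3"
    using norm_triangle_mono[OF w1 w2] unfolding w_eq by linarith
  then have 2: "norm ((8 * h / 6) *\<^sub>R (w - (h ^ 2 / 8) *\<^sub>R H v (F v) (F v))) \<le> (8 * h / 6) * (2 * M ^ 7 * h ^ 3)"
    using h by (intro norm_scaleR_le) auto
  have nw: "norm w \<le> (1 + 2 * T) * M ^ 7 * h ^ 2"
  proof -
    have "norm ((h ^ 2 / 8) *\<^sub>R H v (F v) (F v)) \<le> (h ^ 2 / 8) * (M * M * M)"
      by (intro norm_scaleR_le norm_blinfun_apply_le nH nF) simp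
    also have "\<dots> \<le> h ^ 2 * M ^ 7"
      using M power_increasing[of 3 7 M] by (intro mult_mono) (auto simp: eval_nat_numeral)
    finally have "norm w \<le> 2 * M ^ 7 * h ^ 3 + h ^ 2 * M ^ 7"
      using norm_triangle_mono[OF w] by (metis diff_add_cancel)
    also have "2 * M ^ 7 * h ^ 3 = (2 * M ^ 7 * h ^ 2) * h"
      by (simp add: eval_nat_numeral)
    also have "\<dots> \<le> (2 * M ^ 7 * h ^ 2) * T"
      using h M by (intro mult_left_mono) auto
    finally show ?thesis by (simp add: algebra_simps)
  qed
  have "norm (phi 3 h A w - (1 / 6) *\<^sub>R w) \<le> M * M * ((1 + 2 * T) * M ^ 7 * h ^ 2) * h"
    using pt'[OF nw, of 2 1] by (simp add: fact_numeral)
  then have 3: "norm ((8 * h) *\<^sub>R (phi 3 h A w - (1 / 6) *\<^sub>R w)) \<le> (8 * h) * (M * M * ((1 + 2 * T) * M ^ 7 * h ^ 2) * h)"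
    using h by (intro norm_scaleR_le) auto
  have "phi 1 h A (g v) = phi 1 h A (F v) - phi 1 h A (A v)"
    using phi_diff[OF gen sgb h(1) h', of 0] by (simp add: g_def)
  then have "dpg_step h v = v + h *\<^sub>R phi 1 h A (F v) + (8 * h) *\<^sub>R phi 3 h A w"
    using sg_eq_phi_1[OF gen sgb h(1) h', of v]
    by (simp add: dpg_step_def Let_def w_def g_def d_def A_def scaleR_diff_right)
  \<comment> \<open>The three defects: truncating \<open>\<phi>\<^sub>1\<close>, replacing \<open>\<phi>\<^sub>3\<close> by \<open>1 / 6\<close>, and replacing \<open>w\<close> by its leading part.\<close>
  then have "dpg_step h v - taylor_step h v =
      h *\<^sub>R (phi 1 h A (F v) - (F v + (h / 2) *\<^sub>R D2 v + (h ^ 2 / 6) *\<^sub>R A (D2 v)))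
      + (8 * h) *\<^sub>R (phi 3 h A w - (1 / 6) *\<^sub>R w)
      + (8 * h / 6) *\<^sub>R (w - (h ^ 2 / 8) *\<^sub>R H v (F v) (F v))"
    by (simp add: taylor_step_def D3_def A_def algebra_simps eval_nat_numeral)
  also have "norm \<dots> \<le> h * (M ^ 5 * h ^ 3) + (8 * h) * (M * M * ((1 + 2 * T) * M ^ 7 * h ^ 2) * h)
      + (8 * h / 6) * (2 * M ^ 7 * h ^ 3)"
    by (intro norm_triangle_mono 1 2 3)
  also have "\<dots> = (M ^ 5 + 8 * M ^ 9 * (1 + 2 * T) + (8 / 3) * M ^ 7) * h ^ 4"
    by (simp add: eval_nat_numeral algebra_simps)
  also have "\<dots> \<le> C_loc * h ^ 4"
    unfolding C_loc_def using M T_pos by (intro mult_right_mono add_mono) auto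
  finally show ?thesis .
qed

end

section \<open>Propagation of the error\<close>

lemma gronwall_one_step_error:
  fixes e :: "nat \<Rightarrow> real"
  assumes "e 0 \<le> 0" and "0 \<le> a" "0 \<le> b" and rec: "\<And>k. k < n \<Longrightarrow> e (Suc k) \<le> (1 + a) * e k + b"
  shows "e n \<le> real n * b * exp (a * real n)"
proof -
  have "e k \<le> real k * b * (1 + a) ^ k" if "k \<le> n" for k
    using that
  proof (induction k)
    case (Suc k)
    have "e (Suc k) \<le> (1 + a) * e k + b"
      using Suc.prems by (intro rec) simp
    also have "\<dots> \<le> (1 + a) * (real k * b * (1 + a) ^ k) + b * (1 + a) ^ Suc k"
      using Suc assms one_le_power[of "1 + a" "Suc k"] mult_left_mono[of 1 "(1 + a) ^ Suc k" b]
      by (intro add_mono mult_left_mono) auto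
    also have "\<dots> = real (Suc k) * b * (1 + a) ^ Suc k"
      by (simp add: algebra_simps)
    finally show ?case .
  qed (use assms in auto)
  then have "e n \<le> real n * b * (1 + a) ^ n" by simp
  also have "\<dots> \<le> real n * b * exp a ^ n"
    using assms exp_ge_add_one_self[of a] by (intro mult_left_mono power_mono) auto
  finally show ?thesis
    by (simp add: exp_of_nat_mult[symmetric] mult.commute)
qed

lemma dpg2_unique:
  assumes "dpg2 F b1 b2 u0 h N U" "dpg2 F b1 b2 u0 h N V" "n \<le> N"
  shows "U n = V n"
  using \<open>n \<le> N\<close>
proof (induction n)
  case (Suc n)
  then have "U n = V n" "n < N" by auto
  then show ?case
    using assms(1,2) by (simp add: dpg2_def Let_def)
qed (use assms in \<open>simp add: dpg2_def\<close>)

context smooth_ode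
begin

text \<open>Eliminating \<open>b\<^sub>1\<close> leaves \<open>b\<^sub>2\<close> applied to two arguments; linearity of \<open>\<phi>\<^sub>3(h J)\<close> merges them into their
  difference, which is small.\<close>

lemma dpg2_eq_dpg_step:
  assumes run: "dpg2 F b1 b2 u0 h N U" and n: "n < N" and Un: "U n \<in> strip u T R" and h: "0 \<le> h" "h \<le> T"
    and b: "\<And>x. b1 (h *\<^sub>R J (U n)) x + b2 (h *\<^sub>R J (U n)) x = phi 1 h (J (U n)) x"
      "\<And>x. (1 / 8) *\<^sub>R b2 (h *\<^sub>R J (U n)) x = phi 3 h (J (U n)) x"
  shows "U (Suc n) = dpg_step h (U n)"
proof -
  define A where "A = J (U n)"
  have b2: "b2 (h *\<^sub>R A) x = 8 *\<^sub>R phi 3 h A x" for x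
    by (simp add: A_def flip: b(2))
  have b1: "b1 (h *\<^sub>R A) x = phi 1 h A x - 8 *\<^sub>R phi 3 h A x" for x
    using b(1)[of x] b2[of x] unfolding A_def by (metis add_diff_cancel_right')
  have lin: "phi 3 h A (x - y) = phi 3 h A x - phi 3 h A y" for x y
    using phi_diff[of A "2 * T" M h 2 x y] generates_sg[OF Un] sg_bound[OF Un] h T_pos by (simp add: A_def)
  show ?thesis
    using run n
    by (simp add: dpg2_def dpg_step_def Let_def b1 b2 lin flip: A_def) (simp add: algebra_simps)
qed

definition "C_glob = (C_loc + M ^ 4) * T * exp (L * T)"

lemma C_loc_nonneg: "0 \<le> C_loc"
  using M_nonneg T_pos by (simp add: C_loc_def)

lemma C_glob_nonneg: "0 \<le> C_glob"
  using C_loc_nonneg M_nonneg T_pos by (simp add: C_glob_def)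

text \<open>A bootstrap: the recursion for the error is valid at steps that start within \<open>R / 2\<close> of the solution.
  By smallness of \<open>h\<close>, the third-order bound at all steps before \<open>n\<close> puts them there, so the recursion
  can be summed up to \<open>n\<close> and gives the same bound at \<open>n\<close>. One power of \<open>h\<close> is lost against the local error because \<open>n h \<le> T\<close>.\<close>

lemma global_error:
  assumes start: "U 0 = u 0" and h: "0 \<le> h" "real N * h \<le> T" "M ^ 2 * h \<le> R / 2" "C_glob * h ^ 3 < R / 2"
    and step: "\<And>k. \<lbrakk>k < N; U k \<in> strip u T R\<rbrakk> \<Longrightarrow> U (Suc k) = dpg_step h (U k)"
    and n: "n \<le> N"
  shows "norm (U n - u (real n * h)) \<le> C_glob * h ^ 3"
  using n
proof (induction n rule: less_induct)
  case (less n)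
  define e where "e k = norm (U k - u (real k * h))" for k
  define b where "b = (C_loc + M ^ 4) * h ^ 4"
  have b: "0 \<le> b"
    using C_loc_nonneg M_nonneg h by (simp add: b_def)
  have nh: "real k * h \<le> T" if "k \<le> N" for k
    using that h mult_right_mono[of "real k" "real N" h] by linarith
  have rec: "e (Suc k) \<le> (1 + L * h) * e k + b" if k: "k < n" for k
  proof -
    define t where "t = real k * h"
    have kN: "k < N" "Suc k \<le> N" using k less.prems by auto
    have t_h: "real (Suc k) * h = t + h" by (simp add: t_def algebra_simps)
    have t: "0 \<le> t" "t + h \<le> T" "t \<in> {0..T}"
      using h nh[OF kN(2)] unfolding t_h by (auto simp: t_def)
    have hT: "h \<le> T"
      using t by linarith
    have "e k < R / 2"
      using less.IH[OF k] kN h(4) by (simp add: e_def)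
    then have ball2: "U k \<in> ball (u t) (R / 2)"
      by (simp add: e_def t_def dist_norm norm_minus_commute)
    then have ball: "U k \<in> ball (u t) R"
      using R_pos by simp
    then have "U (Suc k) = dpg_step h (U k)"
      using ball_subset_strip[OF t(3)] by (intro step kN) auto
    then have "U (Suc k) - u (real (Suc k) * h) = (dpg_step h (U k) - taylor_step h (U k))
        + (taylor_step h (U k) - taylor_step h (u t)) + (taylor_step h (u t) - u (t + h))"
      unfolding t_h by simp
    also have "norm \<dots> \<le> C_loc * h ^ 4 + (1 + L * h) * norm (U k - u t) + M ^ 4 * h ^ 4"
      using exact_step[OF t(1) h(1) t(2)]
      by (intro norm_triangle_mono dpg_step_taylor[OF t(3) ball2 h(1) hT h(3)] taylor_step_lipschitz[OF t(3) ball h(1) hT])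
        (simp add: norm_minus_commute)
    finally show ?thesis
      by (simp add: e_def b_def t_def algebra_simps)
  qed
  have "e n \<le> real n * b * exp ((L * h) * real n)"
    by (rule gronwall_one_step_error[where e = e and n = n, OF _ _ b rec]) (use start L_nonneg h in \<open>auto simp: e_def\<close>)
  also have "\<dots> = (real n * h) * ((C_loc + M ^ 4) * h ^ 3) * exp (L * (real n * h))"
    by (simp add: b_def eval_nat_numeral mult_ac)
  also have "\<dots> \<le> T * ((C_loc + M ^ 4) * h ^ 3) * exp (L * T)"
    using nh[OF less.prems] C_loc_nonneg M_nonneg L_nonneg h T_pos
    by (intro mult_mono mult_left_mono mult_right_mono) (auto intro: mult_left_mono)
  also have "\<dots> = C_glob * h ^ 3"
    by (simp add: C_glob_def)
  finally show ?case by (simp add: e_def)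
qed

end

text \<open>Compactness of the trajectory bounds \<open>F\<close> along the solution; the bound on the derivative extends
  this to the strip.\<close>

lemma smooth_odeI:
  fixes F :: "'a::banach \<Rightarrow> 'a"
  assumes T_pos: "T > 0"
    and u_cont: "continuous_on {0..T} u"
    and u_ode: "\<And>t. t \<in> {0<..<T} \<Longrightarrow> (u has_vector_derivative F (u t)) (at t)"
    and F_smooth: "\<exists>R>0. bounded_C3_on F (strip u T R)"
    and semigroup: "\<exists>R>0. \<exists>C \<omega>. \<forall>v\<in>strip u T R.
          (\<exists>S. generates (fderiv F v) S) \<and>
          (\<forall>t\<ge>0. norm (sg (fderiv F v) t) \<le> C * exp (\<omega> * t))"
  obtains R M where "smooth_ode F u T R M"
proof -
  obtain R1 where R1: "R1 > 0" "bounded_C3_on F (strip u T R1)"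
    using F_smooth by blast
  obtain R2 C \<omega> where R2: "R2 > 0"
    and gen: "\<And>v. v \<in> strip u T R2 \<Longrightarrow> \<exists>S. generates (fderiv F v) S"
    and growth: "\<And>v t. \<lbrakk>v \<in> strip u T R2; 0 \<le> t\<rbrakk> \<Longrightarrow> norm (sg (fderiv F v) t) \<le> C * exp (\<omega> * t)"
    using semigroup by blast
  define R where "R = min R1 R2"
  have sub: "v \<in> strip u T R1" "v \<in> strip u T R2" if "v \<in> strip u T R" for v
    using that by (auto simp: strip_def R_def)
  have us: "u t \<in> strip u T R1" if "t \<in> {0..T}" for t
    unfolding strip_def by (rule UN_I[OF that]) (use R1 in simp)
  from R1(2) have diff: "F differentiable (at v)" "fderiv F differentiable (at v)"
    "fderiv (fderiv F) differentiable (at v)" if "v \<in> strip u T R1" for v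
    using that by (auto simp: bounded_C3_on_def)
  from R1(2) obtain M1 M2 M3 where
    "\<forall>v\<in>strip u T R1. norm (fderiv F v) \<le> M1"
    "\<forall>v\<in>strip u T R1. norm (fderiv (fderiv F) v) \<le> M2"
    "\<forall>v\<in>strip u T R1. norm (fderiv (fderiv (fderiv F)) v) \<le> M3"
    by (auto simp: bounded_C3_on_def bounded_iff)
  note M = this[rule_format]
  have "continuous_on {0..T} (\<lambda>t. F (u t))"
    by (rule continuous_on_compose2[OF _ u_cont, of "u ` {0..T}"])
      (auto intro!: continuous_at_imp_continuous_on differentiable_imp_continuous_within diff us)
  then have "bounded ((\<lambda>t. F (u t)) ` {0..T})"
    by (intro compact_imp_bounded compact_continuous_image) auto
  then obtain G where "\<forall>t\<in>{0..T}. norm (F (u t)) \<le> G"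
    by (auto simp: bounded_iff)
  note G = this[rule_format]
  have F_bound: "norm (F v) \<le> \<bar>M1\<bar> * R1 + G" if v: "v \<in> strip u T R1" for v
  proof -
    obtain t where t: "t \<in> {0..T}" "v \<in> ball (u t) R1"
      using v unfolding strip_def by blast
    then have *: "z \<in> strip u T R1" if "z \<in> ball (u t) R1" for z
      using that by (auto simp: strip_def)
    have "norm (F v - F (u t)) \<le> \<bar>M1\<bar> * norm (v - u t)"
      by (rule fderiv_lipschitz_on_ball[OF _ _ t(2)])
        (use R1 in \<open>auto intro: diff(1)[OF *] order_trans[OF M(1)[OF *]]\<close>)
    also have "\<dots> \<le> \<bar>M1\<bar> * R1"
      using t by (intro mult_left_mono) (auto simp: dist_norm norm_minus_commute)
    finally show ?thesis
      using norm_triangle_mono[OF _ G[OF t(1)], of "F v - F (u t)"] by simp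
  qed
  define Q where "Q = \<bar>C\<bar> * exp (\<bar>\<omega>\<bar> * (2 * T))"
  have Q: "norm (sg (fderiv F v) t) \<le> Q" if "v \<in> strip u T R2" "0 \<le> t" "t < 2 * T" for v t
  proof -
    have "\<omega> * t \<le> \<bar>\<omega>\<bar> * (2 * T)"
      using that by (intro mult_mono) auto
    then have "C * exp (\<omega> * t) \<le> Q"
      unfolding Q_def by (intro mult_mono) auto
    with growth[OF that(1,2)] show ?thesis by linarith
  qed
  define M where "M = 1 + \<bar>\<bar>M1\<bar> * R1 + G\<bar> + \<bar>M1\<bar> + \<bar>M2\<bar> + \<bar>M3\<bar> + \<bar>Q\<bar>"
  have le: "c \<le> M" if "c \<le> \<bar>M1\<bar> * R1 + G \<or> c \<le> M1 \<or> c \<le> M2 \<or> c \<le> M3 \<or> c \<le> Q" for c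
    unfolding M_def using that by arith
  have "smooth_ode F u T R M"
  proof
    show "generates (fderiv F v) (sg (fderiv F v))" if "v \<in> strip u T R" for v
      unfolding sg_def by (rule someI_ex[OF gen[OF sub(2)[OF that]]])
    show "0 < R" using R1 R2 by (simp add: R_def)
    show "1 \<le> M" by (simp add: M_def)
    show "norm (F v) \<le> M" "norm (fderiv F v) \<le> M" "norm (fderiv (fderiv F) v) \<le> M"
      "norm (fderiv (fderiv (fderiv F)) v) \<le> M" if "v \<in> strip u T R" for v
      using F_bound[OF sub(1)[OF that]] M[OF sub(1)[OF that]] by (simp_all add: le)
    show "norm (sg (fderiv F v) t) \<le> M" if "v \<in> strip u T R" "0 \<le> t" "t < 2 * T" for v t
      using Q[OF sub(2)[OF that(1)] that(2,3)] by (simp add: le)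
    show "F differentiable (at v)" "fderiv F differentiable (at v)" "fderiv (fderiv F) differentiable (at v)"
      if "v \<in> strip u T R" for v
      by (rule diff[OF sub(1)[OF that]])+
  qed (use T_pos u_cont u_ode in simp_all)
  then show thesis by (rule that)
qed

section \<open>Third-order convergence\<close>

theorem theorem3:
  fixes F :: "'a::banach \<Rightarrow> 'a"
    and u :: "real \<Rightarrow> 'a" and u0 :: 'a and T :: real
    and b1 b2 :: "('a \<Rightarrow>\<^sub>L 'a) \<Rightarrow> 'a \<Rightarrow>\<^sub>L 'a"
  assumes T_pos: "T > 0"
    and u_init: "u 0 = u0"
    and u_cont: "continuous_on {0..<T} u"
    and u_end: "(u \<longlongrightarrow> u T) (at_left T)"
    and u_ode: "\<And>t. t \<in> {0<..<T} \<Longrightarrow> (u has_vector_derivative F (u t)) (at t)"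
    and u_C1: "continuous_on {0<..<T} (\<lambda>t. vector_derivative u (at t))"
    and F_smooth: "\<exists>R>0. bounded_C3_on F (strip u T R)"
    and semigroup: "\<exists>R>0. \<exists>C \<omega>. \<forall>v\<in>strip u T R.
          (\<exists>S. generates (fderiv F v) S) \<and>
          (\<forall>t\<ge>0. norm (sg (fderiv F v) t) \<le> C * exp (\<omega> * t))"
    and stability: "\<exists>CS. \<forall>N\<ge>1. \<forall>U. dpg2 F b1 b2 u0 (T / real N) N U \<longrightarrow>
          (\<forall>\<nu> n. \<nu> \<le> n \<and> n \<le> N \<longrightarrow>
             norm (op_prod (\<lambda>k. sg (fderiv F (U k)) (T / real N)) \<nu> (n - \<nu>)) \<le> CS)"
    and coeffs: "\<And>N U n x. \<lbrakk>N \<ge> 1; dpg2 F b1 b2 u0 (T / real N) N U; n < N\<rbrakk> \<Longrightarrow>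
          (let h = T / real N; J :: 'a \<Rightarrow>\<^sub>L 'a = fderiv F (U n) in
             b1 (h *\<^sub>R J) x + b2 (h *\<^sub>R J) x = phi 1 h J x \<and>
             (1 / 8) *\<^sub>R b2 (h *\<^sub>R J) x = phi 3 h J x)"
  shows "\<exists>C. \<forall>N\<ge>1. \<forall>U. dpg2 F b1 b2 u0 (T / real N) N U \<longrightarrow>
          (\<forall>n\<le>N. norm (U n - u (real n * (T / real N))) \<le> C * (T / real N) ^ 3)"
proof -
  have "continuous_on {0..T} u"
  proof (rule continuous_on_IccI)
    have "continuous_on {0..T / 2} u"
      by (rule continuous_on_subset[OF u_cont]) (use T_pos in auto)
    then show "(u \<longlongrightarrow> u 0) (at_right 0)"
      by (rule continuous_on_Icc_at_rightD) (use T_pos in simp)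
    show "u \<midarrow>t\<rightarrow> u t" if "0 < t" "t < T" for t
      using has_vector_derivative_continuous[OF u_ode[of t]] that by (simp add: isCont_def)
  qed (fact u_end T_pos)+
  then obtain R M where "smooth_ode F u T R M"
    by (rule smooth_odeI[OF T_pos _ u_ode F_smooth semigroup])
  then interpret smooth_ode F u T R M .
  have small: "norm (U n - u (real n * (T / real N))) \<le> C_glob * (T / real N) ^ 3"
    if N: "N \<ge> 1" and run: "dpg2 F b1 b2 u0 (T / real N) N U" and n: "n \<le> N"
      and small: "M ^ 2 * (T / real N) \<le> R / 2" "C_glob * (T / real N) ^ 3 < R / 2" for N U n
  proof (rule global_error[OF _ _ _ small _ n])
    have h: "0 \<le> T / real N" "T / real N \<le> T"
      using T_pos N by (auto simp: divide_le_eq)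
    show "U (Suc k) = dpg_step (T / real N) (U k)" if "k < N" "U k \<in> strip u T R" for k
      using coeffs[OF N run that(1)]
      by (intro dpg2_eq_dpg_step[OF run that h]) (simp_all add: Let_def)
  qed (use run u_init T_pos N in \<open>auto simp: dpg2_def\<close>)
  \<comment> \<open>On a fixed grid the numerical solution is unique, so it has some finite error constant, even if it leaves the strip.\<close>
  have "\<exists>C\<ge>0. \<forall>U. dpg2 F b1 b2 u0 (T / real N) N U \<longrightarrow>
      (\<forall>n\<le>N. norm (U n - u (real n * (T / real N))) \<le> C * (T / real N) ^ 3)" if N: "N \<ge> 1" for N
  proof (cases "\<exists>U. dpg2 F b1 b2 u0 (T / real N) N U")
    case True
    then obtain V where V: "dpg2 F b1 b2 u0 (T / real N) N V" by blast
    define c where "c = (\<Sum>n\<le>N. norm (V n - u (real n * (T / real N))))"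
    have hpos: "0 < (T / real N) ^ 3" using T_pos N by simp
    show ?thesis
    proof (intro exI[of _ "c / (T / real N) ^ 3"] conjI allI impI)
      show "0 \<le> c / (T / real N) ^ 3"
        using hpos by (auto simp: c_def intro!: divide_nonneg_pos sum_nonneg)
      fix U n assume U: "dpg2 F b1 b2 u0 (T / real N) N U" and n: "n \<le> N"
      have "norm (V n - u (real n * (T / real N))) \<le> c"
        unfolding c_def using n by (intro member_le_sum) auto
      then show "norm (U n - u (real n * (T / real N))) \<le> c / (T / real N) ^ 3 * (T / real N) ^ 3"
        using hpos T_pos N by (simp add: dpg2_unique[OF U V n])
    qed
  qed auto
  then obtain c where c: "\<And>N. N \<ge> 1 \<Longrightarrow> 0 \<le> c N" "\<And>N U n. \<lbrakk>N \<ge> 1; dpg2 F b1 b2 u0 (T / real N) N U; n \<le> N\<rbrakk> \<Longrightarrow>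
      norm (U n - u (real n * (T / real N))) \<le> c N * (T / real N) ^ 3"
    by metis
  have lim: "(\<lambda>N. T / real N) \<longlonglongrightarrow> 0"
    by (rule lim_const_over_n)
  have "\<forall>\<^sub>F N in sequentially. M ^ 2 * (T / real N) < R / 2 \<and> C_glob * (T / real N) ^ 3 < R / 2"
  proof (intro eventually_conj)
    have lims: "(\<lambda>N. M ^ 2 * (T / real N)) \<longlonglongrightarrow> M ^ 2 * 0" "(\<lambda>N. C_glob * (T / real N) ^ 3) \<longlonglongrightarrow> C_glob * 0 ^ 3"
      by (intro tendsto_intros lim)+
    show "\<forall>\<^sub>F N in sequentially. M ^ 2 * (T / real N) < R / 2"
      by (rule order_tendstoD(2)[OF lims(1)]) (use R_pos in simp)
    show "\<forall>\<^sub>F N in sequentially. C_glob * (T / real N) ^ 3 < R / 2"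
      by (rule order_tendstoD(2)[OF lims(2)]) (use R_pos in simp)
  qed
  then obtain N0 where N0: "\<And>N. N \<ge> N0 \<Longrightarrow> M ^ 2 * (T / real N) < R / 2 \<and> C_glob * (T / real N) ^ 3 < R / 2"
    by (auto simp: eventually_sequentially)
  \<comment> \<open>Grids coarser than \<open>N0\<close> are finitely many.\<close>
  define C where "C = C_glob + (\<Sum>N\<in>{1..N0}. c N)"
  show ?thesis
  proof (intro exI[of _ C] allI impI)
    fix N U n
    assume N: "1 \<le> (N :: nat)" and run: "dpg2 F b1 b2 u0 (T / real N) N U" and n: "n \<le> N"
    have h: "0 \<le> (T / real N) ^ 3" using T_pos by simp
    have s: "0 \<le> (\<Sum>N\<in>{1..N0}. c N)"
      by (intro sum_nonneg c) auto
    have "\<exists>B\<le>C. norm (U n - u (real n * (T / real N))) \<le> B * (T / real N) ^ 3"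
    proof (cases "N \<ge> N0")
      case True
      with N0[OF True] small[OF N run n] s show ?thesis
        unfolding C_def by (intro exI[of _ C_glob]) auto
    next
      case False
      then have "c N \<le> (\<Sum>N\<in>{1..N0}. c N)"
        using N by (intro member_le_sum c) auto
      with c(2)[OF N run n] C_glob_nonneg show ?thesis
        unfolding C_def by (intro exI[of _ "c N"]) auto
    qed
    then show "norm (U n - u (real n * (T / real N))) \<le> C * (T / real N) ^ 3"
      using h by (meson mult_right_mono order_trans)
  qed
qed

end
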